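(* Let $\bm{\mu}=(\mu_1,\dots,\mu_r)$ be probability measures on $\partial\mathbb{D}$ with Carathéodory functions $F_1,\dots,F_r$. Let $\bm{n}=(n_1,\dots,n_r)\in\mathbb{N}^r$ with $n_j$ even for all $j=1,\dots,r$, and put $\ell_j=n_j/2$, $|\bm{\ell}|=|\bm{n}|/2$. The Hermite–Padé problem of finding Laurent polynomials $\varphi_{\bm{n}},\psi_{\bm{n},1},\dots,\psi_{\bm{n},r}\in\operatorname{span}\{z^k\}_{k=-|\bm{\ell}|}^{|\bm{\ell}|}$ such that for all $j=1,\dots,r$ $$\varphi_{\bm{n}}(z)F_j(z)+\psi_{\bm{n},j}(z)=\mathcal{O}(z^{\ell_j}),\ z\to0,\qquad \varphi_{\bm{n}}(z)F_j(z)+\psi_{\bm{n},j}(z)=\mathcal{O}(z^{-\ell_j-1}),\ z\to\infty,$$ has a unique solution $\varphi_{\bm{n}}$ with $z^{|\bm{n}|/2}$-coefficient equal to $1$ if and only if $\bm{n}$ is $\phi$-normal with respect to $\bm{\mu}$. This solution is then given by $\varphi_{\bm{n}}=\phi_{\bm{n}}$.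
   Context: $\mathbb{N}=\{0,1,2,\dots\}$; $\partial\mathbb{D}=\{z\in\mathbb{C}:|z|=1\}$; $|\bm{n}|=n_1+\dots+n_r$. The Carathéodory function of $\mu_j$ is $F_j(z)=\int_{\partial\mathbb{D}}\frac{w+z}{w-z}\,d\mu_j(w)$, $z\in\mathbb{C}\setminus\partial\mathbb{D}$. Spans are over $\mathbb{C}$. For $\bm{n}$ with all components even, $\bm{n}$ is $\phi$-normal with respect to $\bm{\mu}$ if there exists a unique Laurent polynomial of the form $$\phi_{\bm{n}}(z)=z^{|\bm{n}|/2}+\kappa_{|\bm{n}|/2-1}z^{|\bm{n}|/2-1}+\dots+\kappa_{-|\bm{n}|/2}z^{-|\bm{n}|/2}$$ (complex coefficients) satisfying, for every $j=1,\dots,r$, $\int\phi_{\bm{n}}(z)z^{-k}\,d\mu_j(z)=0$ for $k=-n_j/2,-n_j/2+1,\dots,n_j/2-1$ (no condition if $n_j=0$). The index $\bm{0}$ is normal, with $\phi_{\bm{0}}=1$. *)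

theory Defs
  imports "HOL-Probability.Probability" "HOL-Library.Poly_Mapping" "HOL-Library.Landau_Symbols"
begin

text \<open>Laurent polynomials over the complex numbers are represented by their finitely supported
  coefficient functions.\<close>

type_synonym lpoly = "int \<Rightarrow>\<^sub>0 complex"

definition lp_eval :: "lpoly \<Rightarrow> complex \<Rightarrow> complex" where
  "lp_eval p z = (\<Sum>k\<in>Poly_Mapping.keys p. Poly_Mapping.lookup p k * z powi k)"

text \<open>The span of the monomials $z^k$ with $-m \le k \le m$.\<close>

definition lp_span :: "nat \<Rightarrow> lpoly set" where
  "lp_span m = {p. Poly_Mapping.keys p \<subseteq> {- int m..int m}}"

definition circle_prob :: "complex measure \<Rightarrow> bool" where
  "circle_prob M \<longleftrightarrow> prob_space M \<and> sets M = sets (restrict_space borel (sphere (0::complex) 1))"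

definition caratheodory :: "complex measure \<Rightarrow> complex \<Rightarrow> complex" where
  "caratheodory M z = (LINT w|M. (w + z) / (w - z))"

text \<open>Multi-indices and systems of measures are functions on \<open>nat\<close>, of which only the values
  on \<open>{1..r}\<close> matter.\<close>

definition mi_size :: "nat \<Rightarrow> (nat \<Rightarrow> nat) \<Rightarrow> nat" where
  "mi_size r n = (\<Sum>j=1..r. n j)"

text \<open>The notions below are meant for multi-indices with even components, where \<open>div 2\<close>
  is exact.\<close>

definition is_phi :: "nat \<Rightarrow> (nat \<Rightarrow> complex measure) \<Rightarrow> (nat \<Rightarrow> nat) \<Rightarrow> lpoly \<Rightarrow> bool" where
  "is_phi r \<mu> n p \<longleftrightarrow>
     p \<in> lp_span (mi_size r n div 2) \<and>
     Poly_Mapping.lookup p (int (mi_size r n div 2)) = 1 \<and>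
     (\<forall>j\<in>{1..r}. \<forall>k\<in>{- int (n j div 2)..int (n j div 2) - 1}.
        (LINT z|\<mu> j. lp_eval p z * z powi (- k)) = 0)"

definition phi_normal :: "nat \<Rightarrow> (nat \<Rightarrow> complex measure) \<Rightarrow> (nat \<Rightarrow> nat) \<Rightarrow> bool" where
  "phi_normal r \<mu> n \<longleftrightarrow> (\<exists>!p. is_phi r \<mu> n p)"

definition phi :: "nat \<Rightarrow> (nat \<Rightarrow> complex measure) \<Rightarrow> (nat \<Rightarrow> nat) \<Rightarrow> lpoly" where
  "phi r \<mu> n = (THE p. is_phi r \<mu> n p)"

definition hermite_pade ::
  "nat \<Rightarrow> (nat \<Rightarrow> complex measure) \<Rightarrow> (nat \<Rightarrow> nat) \<Rightarrow> lpoly \<Rightarrow> (nat \<Rightarrow> lpoly) \<Rightarrow> bool" where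
  "hermite_pade r \<mu> n \<phi> \<psi> \<longleftrightarrow>
     \<phi> \<in> lp_span (mi_size r n div 2) \<and>
     (\<forall>j\<in>{1..r}.
        \<psi> j \<in> lp_span (mi_size r n div 2) \<and>
        (\<lambda>z. lp_eval \<phi> z * caratheodory (\<mu> j) z + lp_eval (\<psi> j) z)
          \<in> O[at 0](\<lambda>z. z powi int (n j div 2)) \<and>
        (\<lambda>z. lp_eval \<phi> z * caratheodory (\<mu> j) z + lp_eval (\<psi> j) z)
          \<in> O[at_infinity](\<lambda>z. z powi (- int (n j div 2) - 1)))"

end

theory Submission
  imports Defs
begin

text \<open>
  Fix \<open>j\<close> and let \<open>c\<^sub>k\<close> be the moments \<open>\<integral> w\<^bsup>-k\<^esup> d\<mu>\<^sub>j\<close>. Near \<open>0\<close> the Caratheodory function is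
  \<open>1 + 2 \<Sum>\<^bsub>k\<ge>1\<^esub> c\<^sub>k z\<^sup>k\<close>, and near infinity it is \<open>- 1 - 2 \<Sum>\<^bsub>k\<ge>1\<^esub> c\<^bsub>-k\<^esub> z\<^bsup>-k\<^esup>\<close>. After multiplication by
  \<open>\<phi>\<close>, the condition at \<open>0\<close> prescribes the coefficients of \<open>\<psi>\<^sub>j\<close> of index \<open>< \<ell>\<^sub>j\<close>, and the condition at
  infinity those of index \<open>\<ge> -\<ell>\<^sub>j\<close>. So a \<open>\<psi>\<^sub>j\<close> exists if and only if the two prescriptions agree on the
  overlap \<open>-\<ell>\<^sub>j \<le> m < \<ell>\<^sub>j\<close>. There they differ by \<open>2 \<Sum>\<^sub>k \<phi>\<^sub>k c\<^bsub>m-k\<^esub> = 2 \<integral> \<phi>(w) w\<^bsup>-m\<^esup> d\<mu>\<^sub>j(w)\<close>, whose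
  vanishing is precisely the orthogonality condition.
\<close>

section \<open>Arithmetic of Laurent polynomials and their values\<close>

lemma lp_eval_superset:
  assumes "finite S" "Poly_Mapping.keys p \<subseteq> S"
  shows "lp_eval p z = (\<Sum>k\<in>S. Poly_Mapping.lookup p k * z powi k)"
  unfolding lp_eval_def
  by (rule sum.mono_neutral_left) (use assms in \<open>auto simp: in_keys_iff\<close>)

lemma lp_eval_add: "lp_eval (p + q) z = lp_eval p z + lp_eval q z"
proof -
  let ?S = "Poly_Mapping.keys p \<union> Poly_Mapping.keys q"
  have "finite ?S" "Poly_Mapping.keys (p + q) \<subseteq> ?S"
    using Poly_Mapping.keys_add[of p q] by auto
  then show ?thesis
    by (simp add: lp_eval_superset[of ?S] lookup_add sum.distrib distrib_right)
qed

lemma lp_eval_zero [simp]: "lp_eval 0 z = 0"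
  by (simp add: lp_eval_def)

lemma lp_eval_single [simp]: "lp_eval (Poly_Mapping.single k c) z = c * z powi k"
  by (simp add: lp_eval_def)

lemma lp_eval_one [simp]: "lp_eval 1 z = 1"
  using lp_eval_single[of 0 1 z] by (simp del: lp_eval_single)

lemma lp_eval_uminus: "lp_eval (- p) z = - lp_eval p z"
  using lp_eval_add[of p "- p" z] by (simp add: eq_neg_iff_add_eq_0 add.commute)

lemma lp_eval_sum: "lp_eval (sum f A) z = (\<Sum>a\<in>A. lp_eval (f a) z)"
  by (induction A rule: infinite_finite_induct) (auto simp: lp_eval_add)

lemma lpoly_sum_singles:
  "p = (\<Sum>k\<in>Poly_Mapping.keys p. Poly_Mapping.single k (Poly_Mapping.lookup p k))" for p :: lpoly
  by (rule poly_mapping_eqI) (simp add: lookup_sum lookup_single when_def in_keys_iff)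

text \<open>Both factors are expanded into monomials, for which the claim is the addition law of
  exponents. At \<open>z = 0\<close> it fails: the monomials of exponents 1 and -1 have product
  \<open>1\<close>, but both evaluate to 0 there.\<close>

lemma lp_eval_mult:
  assumes "z \<noteq> 0"
  shows "lp_eval (p * q) z = lp_eval p z * lp_eval q z"
proof -
  have "lp_eval (p * q) z = lp_eval
      ((\<Sum>k\<in>Poly_Mapping.keys p. Poly_Mapping.single k (Poly_Mapping.lookup p k)) *
       (\<Sum>k\<in>Poly_Mapping.keys q. Poly_Mapping.single k (Poly_Mapping.lookup q k))) z"
    by (simp flip: lpoly_sum_singles)
  also have "\<dots> = lp_eval p z * lp_eval q z"
    using assms unfolding lp_eval_def[of p] lp_eval_def[of q]
    by (simp add: sum_product mult_single lp_eval_sum power_int_add mult_ac)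
  finally show ?thesis .
qed

lemma lookup_lpoly_mult:
  "Poly_Mapping.lookup (p * q) m =
     (\<Sum>k\<in>Poly_Mapping.keys p. Poly_Mapping.lookup p k * Poly_Mapping.lookup q (m - k))"
  for p q :: lpoly
proof -
  have "Poly_Mapping.lookup (p * q) m = Poly_Mapping.lookup
      ((\<Sum>k\<in>Poly_Mapping.keys p. Poly_Mapping.single k (Poly_Mapping.lookup p k)) *
       (\<Sum>k\<in>Poly_Mapping.keys q. Poly_Mapping.single k (Poly_Mapping.lookup q k))) m"
    by (simp flip: lpoly_sum_singles)
  also have "\<dots> = (\<Sum>k\<in>Poly_Mapping.keys p. \<Sum>i\<in>Poly_Mapping.keys q.
      Poly_Mapping.lookup p k * (if i = m - k then Poly_Mapping.lookup q i else 0))"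
    unfolding sum_product
    by (simp add: lookup_sum mult_single lookup_single when_def) (intro sum.cong refl, auto)
  also have "\<dots> = (\<Sum>k\<in>Poly_Mapping.keys p. Poly_Mapping.lookup p k * Poly_Mapping.lookup q (m - k))"
    by (intro sum.cong refl) (auto simp: sum_distrib_left[symmetric] in_keys_iff)
  finally show ?thesis .
qed

section \<open>Growth of Laurent polynomials at 0 and at infinity\<close>

lemma powi_bigo_at_0:
  assumes "l \<le> k"
  shows "(\<lambda>z::complex. z powi k) \<in> O[at 0](\<lambda>z. z powi l)"
proof (rule bigoI[of _ 1])
  have "eventually (\<lambda>z::complex. norm z < 1 \<and> z \<noteq> 0) (at 0)"
    using eventually_at_ball'[of 1 "0::complex" UNIV] by (auto simp: elim: eventually_mono)
  then show "eventually (\<lambda>z::complex. norm (z powi k) \<le> 1 * norm (z powi l)) (at 0)"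
  proof (rule eventually_mono)
    fix z :: complex assume z: "norm z < 1 \<and> z \<noteq> 0"
    have "z powi k = z powi l * z ^ nat (k - l)"
      using z assms by (simp add: power_int_of_nat[symmetric] flip: power_int_add)
    moreover have "norm z ^ nat (k - l) \<le> 1" using z by (simp add: power_le_one)
    ultimately show "norm (z powi k) \<le> 1 * norm (z powi l)"
      using z by (simp add: norm_mult norm_power mult_left_le)
  qed
qed

text \<open>The lowest power with a nonzero coefficient dominates near 0. If its exponent
  \<open>k0\<close> were below \<open>l\<close>, dividing by its power would give a function that
  tends to \<open>a k0\<close> and, by the assumed bound, also to 0.\<close>

lemma laurent_bigo_at_0_iff:
  assumes "finite S"
  shows "(\<lambda>z::complex. \<Sum>k\<in>S. a k * z powi k) \<in> O[at 0](\<lambda>z. z powi l) \<longleftrightarrow>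
         (\<forall>k\<in>S. k < l \<longrightarrow> a k = 0)"
proof
  assume "\<forall>k\<in>S. k < l \<longrightarrow> a k = 0"
  then have "(\<lambda>z::complex. a k * z powi k) \<in> O[at 0](\<lambda>z. z powi l)" if "k \<in> S" for k
    using that powi_bigo_at_0[of l k] by (cases "k < l") auto
  then show "(\<lambda>z::complex. \<Sum>k\<in>S. a k * z powi k) \<in> O[at 0](\<lambda>z. z powi l)"
    by (rule big_sum_in_bigo)
next
  assume O: "(\<lambda>z::complex. \<Sum>k\<in>S. a k * z powi k) \<in> O[at 0](\<lambda>z. z powi l)"
  show "\<forall>k\<in>S. k < l \<longrightarrow> a k = 0"
  proof (rule ccontr)
    assume "\<not> (\<forall>k\<in>S. k < l \<longrightarrow> a k = 0)"
    define B where "B = {k\<in>S. a k \<noteq> 0}"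
    define k0 where "k0 = Min B"
    from \<open>\<not> _\<close> obtain k1 where k1: "k1 \<in> B" "k1 < l" by (auto simp: B_def)
    have fB: "finite B" using assms by (simp add: B_def)
    have k0_le: "k0 \<le> k" if "k \<in> B" for k using that fB by (simp add: k0_def)
    have k0: "k0 \<in> B" "k0 < l"
      using Min_in[OF fB] k1 k0_le[OF k1(1)] unfolding k0_def by (blast, linarith)
    have nz: "eventually (\<lambda>z::complex. z \<noteq> 0) (at 0)"
      by (simp add: eventually_at_filter)
    \<comment> \<open>Since \<open>k0\<close> is minimal in \<open>B\<close>, division by its power
      leaves natural exponents only, so the sum is continuous at 0. There \<open>0 ^ 0 = 1\<close>
      retains exactly the term of \<open>k0\<close>.\<close>
    have "((\<lambda>z::complex. \<Sum>k\<in>B. a k * z ^ nat (k - k0)) \<longlongrightarrow> (\<Sum>k\<in>B. a k * 0 ^ nat (k - k0))) (at 0)"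
      by (intro tendsto_intros)
    also have "(\<Sum>k\<in>B. a k * 0 ^ nat (k - k0)) = (\<Sum>k\<in>B. if k = k0 then a k else 0)"
      by (intro sum.cong refl) (use k0_le in \<open>force simp: power_0_left\<close>)
    also have "\<dots> = a k0" using k0 fB by simp
    finally have lim1: "((\<lambda>z. \<Sum>k\<in>B. a k * z ^ nat (k - k0)) \<longlongrightarrow> a k0) (at 0)" .
    have "(\<lambda>z. z powi (- k0) * (\<Sum>k\<in>S. a k * z powi k)) \<in> O[at 0](\<lambda>z. z powi (- k0) * z powi l)"
      by (intro landau_o.big.mult O) simp
    also have "eventually (\<lambda>z::complex. z powi (- k0) * z powi l = z powi (l - k0)) (at 0)"
      using nz by eventually_elim (simp flip: power_int_add)
    then have "O[at 0](\<lambda>z::complex. z powi (- k0) * z powi l) = O[at 0](\<lambda>z. z powi (l - k0))"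
      by (rule landau_o.big.cong)
    also have "eventually (\<lambda>z. z powi (- k0) * (\<Sum>k\<in>S. a k * z powi k) =
        (\<Sum>k\<in>B. a k * z ^ nat (k - k0))) (at 0)"
      using nz
    proof eventually_elim
      case (elim z)
      have "(\<Sum>k\<in>S. a k * z powi k) = (\<Sum>k\<in>B. a k * z powi k)"
        by (rule sum.mono_neutral_right) (use assms in \<open>auto simp: B_def\<close>)
      moreover have "z powi (- k0) * (a k * z powi k) = a k * z ^ nat (k - k0)" if "k \<in> B" for k
      proof -
        have "z powi (- k0) * (a k * z powi k) = a k * z powi (- k0 + k)"
          using elim by (subst power_int_add) auto
        also have "- k0 + k = int (nat (k - k0))" using k0_le[OF that] by simp
        finally show ?thesis by (simp only: power_int_of_nat)
      qed
      ultimately show ?case by (simp only: sum_distrib_left cong: sum.cong)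
    qed
    then have "(\<lambda>z. z powi (- k0) * (\<Sum>k\<in>S. a k * z powi k)) \<in> O[at 0](\<lambda>z. z powi (l - k0)) \<longleftrightarrow>
        (\<lambda>z. \<Sum>k\<in>B. a k * z ^ nat (k - k0)) \<in> O[at 0](\<lambda>z. z powi (l - k0))"
      by (rule landau_o.big.in_cong)
    finally have "(\<lambda>z. \<Sum>k\<in>B. a k * z ^ nat (k - k0)) \<in> O[at 0](\<lambda>z. z powi (l - k0))" .
    \<comment> \<open>Exponents are integers, so \<open>k0 < l\<close> leaves at least one factor
      \<open>z\<close>, which forces the limit 0.\<close>
    also have "(\<lambda>z::complex. z powi (l - k0)) \<in> O[at 0](\<lambda>z. z powi 1)"
      by (rule powi_bigo_at_0) (use k0 in auto)
    also have "(\<lambda>z::complex. z powi 1) \<in> o[at 0](\<lambda>_. 1)"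
      by (rule smalloI_tendsto) (auto intro: tendsto_eq_intros)
    finally have "((\<lambda>z. \<Sum>k\<in>B. a k * z ^ nat (k - k0)) \<longlongrightarrow> 0) (at 0)"
      by (auto dest: smalloD_tendsto)
    with lim1 have "a k0 = 0" by (rule tendsto_unique[rotated]) simp
    with k0 show False by (simp add: B_def)
  qed
qed

lemma lp_eval_bigo_at_0_iff:
  "lp_eval p \<in> O[at 0](\<lambda>z. z powi l) \<longleftrightarrow> (\<forall>k<l. Poly_Mapping.lookup p k = 0)"
proof -
  have "lp_eval p \<in> O[at 0](\<lambda>z. z powi l) \<longleftrightarrow>
      (\<forall>k\<in>Poly_Mapping.keys p. k < l \<longrightarrow> Poly_Mapping.lookup p k = 0)"
    unfolding lp_eval_def[abs_def] by (rule laurent_bigo_at_0_iff) simp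
  then show ?thesis by (auto simp: in_keys_iff)
qed

lemma bigo_at_infinity_iff:
  "f \<in> O[at_infinity](g) \<longleftrightarrow> (\<lambda>z::complex. f (inverse z)) \<in> O[at 0](\<lambda>z. g (inverse z))"
  by (simp add: at_to_infinity landau_o.big.in_filtermap_iff)

text \<open>Inversion carries infinity to 0 and negates exponents, which turns the condition
  \<open>k > l\<close> into \<open>- k < - l\<close> and reduces the claim to the criterion at
  0.\<close>

lemma lp_eval_bigo_at_infinity_iff:
  "lp_eval p \<in> O[at_infinity](\<lambda>z. z powi l) \<longleftrightarrow> (\<forall>k>l. Poly_Mapping.lookup p k = 0)"
proof -
  have "lp_eval p (inverse z) =
      (\<Sum>k\<in>uminus ` Poly_Mapping.keys p. Poly_Mapping.lookup p (- k) * z powi k)" for z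
    by (simp add: lp_eval_def sum.reindex power_int_inverse power_int_minus)
  then have "lp_eval p \<in> O[at_infinity](\<lambda>z. z powi l) \<longleftrightarrow>
     (\<lambda>z. \<Sum>k\<in>uminus ` Poly_Mapping.keys p. Poly_Mapping.lookup p (- k) * z powi k)
        \<in> O[at 0](\<lambda>z. z powi (- l))"
    by (simp add: bigo_at_infinity_iff power_int_inverse power_int_minus)
  also have "\<dots> \<longleftrightarrow>
     (\<forall>k\<in>uminus ` Poly_Mapping.keys p. k < - l \<longrightarrow> Poly_Mapping.lookup p (- k) = 0)"
    by (rule laurent_bigo_at_0_iff) simp
  finally show ?thesis by (auto simp: in_keys_iff)
qed

text \<open>Replacing \<open>f\<close> by its approximation \<open>t\<close> changes the expression
  by \<open>p * (f - t)\<close>, of order \<open>z powi (a + b)\<close>, which the target order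
  absorbs. The filter \<open>G\<close> is left general so that 0 and infinity are both
  covered.\<close>

lemma laurent_approx_bigo_iff:
  fixes f :: "complex \<Rightarrow> complex"
  assumes nz: "eventually (\<lambda>z. z \<noteq> 0) G"
    and p: "lp_eval p \<in> O[G](\<lambda>z. z powi a)"
    and f: "(\<lambda>z. f z - lp_eval t z) \<in> O[G](\<lambda>z. z powi b)"
    and ab: "(\<lambda>z::complex. z powi (a + b)) \<in> O[G](\<lambda>z. z powi l)"
  shows "(\<lambda>z. lp_eval p z * f z + lp_eval q z) \<in> O[G](\<lambda>z. z powi l) \<longleftrightarrow>
         lp_eval (p * t + q) \<in> O[G](\<lambda>z. z powi l)"
proof -
  have "(\<lambda>z. lp_eval p z * (f z - lp_eval t z)) \<in> O[G](\<lambda>z. z powi a * z powi b)"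
    by (intro landau_o.big.mult p f)
  also have "O[G](\<lambda>z::complex. z powi a * z powi b) = O[G](\<lambda>z. z powi (a + b))"
    by (rule landau_o.big.cong) (use nz in \<open>eventually_elim, simp add: power_int_add\<close>)
  also note ab
  finally have err: "(\<lambda>z. lp_eval p z * (f z - lp_eval t z)) \<in> O[G](\<lambda>z. z powi l)" .
  have "(\<lambda>z. lp_eval p z * f z + lp_eval q z) \<in> O[G](\<lambda>z. z powi l) \<longleftrightarrow>
      (\<lambda>z. lp_eval (p * t + q) z + lp_eval p z * (f z - lp_eval t z)) \<in> O[G](\<lambda>z. z powi l)"
    by (rule landau_o.big.in_cong)
       (use nz in \<open>eventually_elim, simp add: lp_eval_add lp_eval_mult algebra_simps\<close>)
  also have "\<dots> \<longleftrightarrow> lp_eval (p * t + q) \<in> O[G](\<lambda>z. z powi l)"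
    \<comment> \<open>The two rules serve the two directions: the error term is added or subtracted
      again.\<close>
    using sum_in_bigo(1)[OF _ err] sum_in_bigo(2)[OF _ err] by fastforce
  finally show ?thesis .
qed

section \<open>Moments and truncated expansions of the Caratheodory function\<close>

definition moment :: "complex measure \<Rightarrow> int \<Rightarrow> complex" where
  "moment M k = (LINT w|M. w powi (- k))"

text \<open>The Taylor polynomial of degree \<open>N\<close> at 0, from integrating
  \<open>(w + z) / (w - z) = 1 + 2 \<Sum> (z / w)^k\<close>. The sign in \<open>moment\<close> makes
  its index equal to the exponent of \<open>z\<close>. As an \<open>lpoly\<close>, the jet can be
  multiplied by \<open>p\<close> algebraically.\<close>

definition caratheodory_jet_0 :: "complex measure \<Rightarrow> nat \<Rightarrow> lpoly" where
  "caratheodory_jet_0 M N =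
     1 + (\<Sum>k=1..N. Poly_Mapping.single (int k) (2 * moment M (int k)))"

text \<open>The analogous truncation in powers of \<open>1 / z\<close>, where \<open>F\<close> tends
  to -1.\<close>

definition caratheodory_jet_infinity :: "complex measure \<Rightarrow> nat \<Rightarrow> lpoly" where
  "caratheodory_jet_infinity M N =
     - (1 + (\<Sum>k=1..N. Poly_Mapping.single (- int k) (2 * moment M (- int k))))"

section \<open>Integration over the unit circle\<close>

lemma circle_prob_space: "circle_prob M \<Longrightarrow> w \<in> space M \<Longrightarrow> norm w = 1"
  using sets_eq_imp_space_eq[of M "restrict_space borel (sphere 0 1)"]
  by (auto simp: circle_prob_def space_restrict_space)

lemma circle_prob_integrable:
  fixes f :: "complex \<Rightarrow> complex"
  assumes M: "circle_prob M" and f: "continuous_on (sphere 0 1) f"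
  shows "integrable M f"
proof -
  interpret prob_space M using M by (simp add: circle_prob_def)
  have sets: "sets M = sets (restrict_space borel (sphere 0 1))"
    using M by (simp add: circle_prob_def)
  have "f \<in> borel_measurable (restrict_space borel (sphere 0 1))"
    using f by (rule borel_measurable_continuous_on_restrict)
  then have meas: "f \<in> borel_measurable M"
    by (simp add: measurable_cong_sets[OF sets refl])
  have "compact (f ` sphere 0 1)" by (intro compact_continuous_image f) simp
  then obtain B where "\<And>w. w \<in> sphere 0 1 \<Longrightarrow> norm (f w) \<le> B"
    using compact_imp_bounded by (force simp: bounded_iff)
  then show ?thesis
    using circle_prob_space[OF M]
    by (intro integrable_const_bound[where B = B] meas AE_I2) auto
qed

lemma circle_prob_norm_LINT_le:
  fixes f :: "complex \<Rightarrow> complex"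
  assumes M: "circle_prob M" and f: "continuous_on (sphere 0 1) f"
    and B: "\<And>w. norm w = 1 \<Longrightarrow> norm (f w) \<le> B"
  shows "norm (LINT w|M. f w) \<le> B"
proof -
  interpret prob_space M using M by (simp add: circle_prob_def)
  have "(LINT w|M. norm (f w)) \<le> (LINT w|M. B)"
    using circle_prob_integrable[OF M f] B circle_prob_space[OF M] by (intro integral_mono) auto
  then show ?thesis
    using order_trans[OF integral_norm_bound[of M f]] by (simp add: prob_space)
qed

section \<open>Remainder estimates for the Caratheodory function\<close>

lemma cayley_geometric_bound:
  fixes q :: complex
  assumes "norm q \<le> 1 / 2"
  shows "norm ((1 + q) / (1 - q) - (1 + 2 * (\<Sum>k=1..N. q ^ k))) \<le> 4 * norm q ^ (N + 1)"
proof -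
  have q: "1 - q \<noteq> 0" using assms by auto
  \<comment> \<open>The remainder of the geometric series is computed exactly. The factor 2 and the
    bound \<open>norm (1 - q) \<ge> 1 / 2\<close> then give the constant 4.\<close>
  have "(1 + q) / (1 - q) - (1 + 2 * (\<Sum>k=1..N. q ^ k)) = 2 * q ^ (N + 1) / (1 - q)"
  proof (induction N)
    case 0
    show ?case using q by (simp add: field_simps)
  next
    case (Suc N)
    then show ?case using q by (simp add: field_simps)
  qed
  moreover have "norm (1 - q) \<ge> 1 / 2"
    using norm_triangle_ineq2[of 1 q] assms by simp
  then have "2 * norm q ^ (N + 1) / norm (1 - q) \<le> 2 * norm q ^ (N + 1) / (1 / 2)"
    by (intro divide_left_mono) auto
  ultimately show ?thesis by (simp add: norm_divide norm_mult norm_power)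
qed

lemma continuous_on_circle_powi [continuous_intros]:
  "continuous_on (sphere 0 1) (\<lambda>w::complex. w powi k)"
  by (intro continuous_intros) auto

text \<open>One estimate for both expansions: \<open>u = z\<close>, \<open>e = 1\<close> at 0 and
  \<open>u = 1 / z\<close>, \<open>e = - 1\<close> at infinity. On the circle
  \<open>u * w powi (- e)\<close> has modulus \<open>norm u\<close>, so the pointwise remainder
  bound is uniform in \<open>w\<close> and survives integration against a probability
  measure.\<close>

lemma LINT_cayley_expansion:
  assumes M: "circle_prob M" and u: "norm u \<le> 1 / 2"
  shows "norm ((LINT w|M. (1 + u * w powi (- e)) / (1 - u * w powi (- e))) -
           (1 + (\<Sum>k=1..N. 2 * moment M (e * int k) * u ^ k))) \<le> 4 * norm u ^ (N + 1)"
proof -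
  interpret prob_space M using M by (simp add: circle_prob_def)
  let ?q = "\<lambda>w. u * w powi (- e)"
  let ?f = "\<lambda>w. (1 + ?q w) / (1 - ?q w)"
  let ?g = "\<lambda>w. 1 + (\<Sum>k=1..N. 2 * u ^ k * w powi (- (e * int k)))"
  have q: "norm (?q w) = norm u" if "norm w = 1" for w :: complex
    using that by (simp add: norm_mult norm_power_int)
  then have "1 - ?q w \<noteq> 0" if "norm w = 1" for w :: complex
    using that u by force
  then have cf: "continuous_on (sphere 0 1) ?f" by (intro continuous_intros) auto
  have cg: "continuous_on (sphere 0 1) ?g" by (intro continuous_intros)
  have "(LINT w|M. ?g w) = 1 + (\<Sum>k=1..N. 2 * u ^ k * (LINT w|M. w powi (- (e * int k))))"
    by (simp add: Bochner_Integration.integral_add Bochner_Integration.integral_sum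
          circle_prob_integrable[OF M] continuous_intros prob_space)
  then have "(LINT w|M. ?f w) - (1 + (\<Sum>k=1..N. 2 * moment M (e * int k) * u ^ k)) =
      (LINT w|M. ?f w - ?g w)"
    using Bochner_Integration.integral_diff[OF circle_prob_integrable[OF M cf]
        circle_prob_integrable[OF M cg]]
    by (simp add: moment_def mult_ac)
  moreover have "norm (LINT w|M. ?f w - ?g w) \<le> 4 * norm u ^ (N + 1)"
  proof (rule circle_prob_norm_LINT_le[OF M])
    show "continuous_on (sphere 0 1) (\<lambda>w. ?f w - ?g w)" by (intro continuous_on_diff cf cg)
    fix w :: complex assume w: "norm w = 1"
    have "?q w ^ k = u ^ k * w powi (- (e * int k))" for k
      using power_int_mult[of w "- e" "int k"] by (simp add: power_mult_distrib)
    then have "?g w = 1 + 2 * (\<Sum>k=1..N. ?q w ^ k)"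
      by (simp add: sum_distrib_left mult_ac)
    then show "norm (?f w - ?g w) \<le> 4 * norm u ^ (N + 1)"
      using cayley_geometric_bound[of "?q w" N] q[OF w] u by simp
  qed
  ultimately show ?thesis by simp
qed

lemma caratheodory_bigo_at_0:
  assumes M: "circle_prob M"
  shows "(\<lambda>z. caratheodory M z - lp_eval (caratheodory_jet_0 M N) z)
           \<in> O[at 0](\<lambda>z. z powi (int N + 1))"
proof (rule bigoI[of _ 4])
  have "eventually (\<lambda>z::complex. norm z \<le> 1 / 2) (at 0)"
    using eventually_at_ball[of "1 / 2" "0::complex" UNIV] by (auto elim: eventually_mono)
  then show "eventually (\<lambda>z. norm (caratheodory M z - lp_eval (caratheodory_jet_0 M N) z)
      \<le> 4 * norm (z powi (int N + 1))) (at 0)"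
  proof eventually_elim
    case (elim z)
    \<comment> \<open>Numerator and denominator are divided by \<open>w\<close>.\<close>
    have "caratheodory M z = (LINT w|M. (1 + z * w powi (- 1)) / (1 - z * w powi (- 1)))"
      unfolding caratheodory_def
    proof (intro Bochner_Integration.integral_cong refl)
      fix w assume "w \<in> space M"
      then have "norm w = 1" by (rule circle_prob_space[OF M])
      then have "w \<noteq> 0" "w - z \<noteq> 0" using elim by auto
      then show "(w + z) / (w - z) = (1 + z * w powi (- 1)) / (1 - z * w powi (- 1))"
        by (simp add: power_int_minus divide_simps)
    qed
    moreover have "lp_eval (caratheodory_jet_0 M N) z = 1 + (\<Sum>k=1..N. 2 * moment M (1 * int k) * z ^ k)"
      by (simp add: caratheodory_jet_0_def lp_eval_add lp_eval_sum)
    moreover have "z powi (int N + 1) = z ^ (N + 1)"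
      using power_int_of_nat[of z "N + 1"] by (simp add: add.commute)
    ultimately show ?case
      using LINT_cayley_expansion[OF M elim, of 1 N] by (simp add: norm_power norm_mult)
  qed
qed

lemma caratheodory_bigo_at_infinity:
  assumes M: "circle_prob M"
  shows "(\<lambda>z. caratheodory M z - lp_eval (caratheodory_jet_infinity M N) z)
           \<in> O[at_infinity](\<lambda>z. z powi (- int N - 1))"
proof (rule bigoI[of _ 4])
  have "eventually (\<lambda>z::complex. 2 \<le> norm z) at_infinity"
    by (auto simp: eventually_at_infinity)
  then show "eventually (\<lambda>z. norm (caratheodory M z - lp_eval (caratheodory_jet_infinity M N) z)
      \<le> 4 * norm (z powi (- int N - 1))) at_infinity"
  proof eventually_elim
    case (elim z)
    define u where "u = inverse z"
    have z: "z \<noteq> 0" using elim by auto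
    have u: "norm u \<le> 1 / 2" using elim le_imp_inverse_le[OF elim] by (simp add: u_def norm_inverse)
    \<comment> \<open>Dividing by \<open>z\<close> instead of \<open>w\<close> gives
      \<open>(w / z + 1) / (w / z - 1)\<close>, hence the minus sign.\<close>
    have "caratheodory M z =
        (LINT w|M. - ((1 + u * w powi (- (- 1))) / (1 - u * w powi (- (- 1)))))"
      unfolding caratheodory_def
    proof (intro Bochner_Integration.integral_cong refl)
      fix w assume "w \<in> space M"
      then have "norm w = 1" by (rule circle_prob_space[OF M])
      then have "w - z \<noteq> 0" "z - w \<noteq> 0" using elim by auto
      then show "(w + z) / (w - z) = - ((1 + u * w powi (- (- 1))) / (1 - u * w powi (- (- 1))))"
        using z by (simp add: u_def divide_simps) (simp add: algebra_simps)
    qed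
    then have "caratheodory M z =
        - (LINT w|M. (1 + u * w powi (- (- 1))) / (1 - u * w powi (- (- 1))))"
      by simp
    moreover have "lp_eval (caratheodory_jet_infinity M N) z =
        - (1 + (\<Sum>k=1..N. 2 * moment M (- 1 * int k) * u ^ k))"
      unfolding caratheodory_jet_infinity_def lp_eval_uminus lp_eval_add lp_eval_sum
      by (simp add: u_def power_int_minus power_inverse)
    moreover have "- int N - 1 = - int (N + 1)" by simp
    then have "z powi (- int N - 1) = u ^ (N + 1)"
      by (simp only: power_int_minus power_int_of_nat u_def power_inverse)
    ultimately show ?case
      using LINT_cayley_expansion[OF M u, of "- 1" N]
      by (simp only: minus_diff_minus norm_minus_cancel norm_power)
  qed
qed

section \<open>Coefficients of the jets and of their products with a Laurent polynomial\<close>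

lemma lookup_caratheodory_jet_0:
  "Poly_Mapping.lookup (caratheodory_jet_0 M N) m =
     (if m = 0 then 1 else if 0 < m \<and> m \<le> int N then 2 * moment M m else 0)"
proof -
  \<comment> \<open>The sum is rewritten to have at most one nonzero term, at
    \<open>k = nat m\<close>. For \<open>m \<le> 0\<close> this index is 0, outside the range of
    summation.\<close>
  have "(\<Sum>k=1..N. Poly_Mapping.lookup (Poly_Mapping.single (int k) (2 * moment M (int k))) m) =
      (\<Sum>k=1..N. if k = nat m then if 0 < m then 2 * moment M m else 0 else 0)"
    by (intro sum.cong) (auto simp: lookup_single when_def)
  then show ?thesis
    by (auto simp: caratheodory_jet_0_def lookup_add lookup_sum lookup_one when_def)
qed

lemma lookup_caratheodory_jet_infinity:
  "Poly_Mapping.lookup (caratheodory_jet_infinity M N) m =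
     (if m = 0 then - 1 else if m < 0 \<and> - int N \<le> m then - 2 * moment M m else 0)"
proof -
  have "(\<Sum>k=1..N. Poly_Mapping.lookup (Poly_Mapping.single (- int k) (2 * moment M (- int k))) m) =
      (\<Sum>k=1..N. if k = nat (- m) then if m < 0 then 2 * moment M m else 0 else 0)"
    by (intro sum.cong) (auto simp: lookup_single when_def)
  then show ?thesis
    unfolding caratheodory_jet_infinity_def lookup_uminus lookup_add lookup_sum
    by (auto simp: lookup_one when_def)
qed

lemma LINT_lp_eval_powi:
  assumes M: "circle_prob M"
  shows "(LINT w|M. lp_eval p w * w powi (- m)) =
     (\<Sum>k\<in>Poly_Mapping.keys p. Poly_Mapping.lookup p k * moment M (m - k))"
proof -
  have "(LINT w|M. lp_eval p w * w powi (- m)) =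
      (LINT w|M. (\<Sum>k\<in>Poly_Mapping.keys p. Poly_Mapping.lookup p k * w powi (- (m - k))))"
  proof (intro Bochner_Integration.integral_cong refl)
    fix w assume "w \<in> space M"
    then have "w \<noteq> 0" using circle_prob_space[OF M] by force
    then have "w powi (- (m - k)) = w powi k * w powi (- m)" for k
      by (simp flip: power_int_add)
    then show "lp_eval p w * w powi (- m) =
        (\<Sum>k\<in>Poly_Mapping.keys p. Poly_Mapping.lookup p k * w powi (- (m - k)))"
      by (simp add: lp_eval_def sum_distrib_right mult.assoc)
  qed
  also have "\<dots> = (\<Sum>k\<in>Poly_Mapping.keys p. Poly_Mapping.lookup p k * moment M (m - k))"
    unfolding moment_def
    by (subst Bochner_Integration.integral_sum)
       (auto intro!: circle_prob_integrable[OF M] continuous_on_mult continuous_on_const continuous_on_circle_powi)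
  finally show ?thesis .
qed

text \<open>The two jets differ by \<open>2 * moment M i\<close> at every index \<open>i\<close>
  with \<open>\<bar>i\<bar> \<le> 2 * L\<close>; at \<open>i = 0\<close> this reads
  \<open>1 - (- 1) = 2\<close>, because the total mass is 1. The length \<open>2 * L\<close>
  suffices since \<open>m - k\<close> is a difference of two indices of modulus at most
  \<open>L\<close>.\<close>

lemma lookup_mult_jet_difference:
  assumes M: "circle_prob M" and p: "p \<in> lp_span L" and m: "\<bar>m\<bar> \<le> int L"
  shows "Poly_Mapping.lookup (p * caratheodory_jet_0 M (2 * L)) m -
         Poly_Mapping.lookup (p * caratheodory_jet_infinity M (2 * L)) m =
         2 * (LINT w|M. lp_eval p w * w powi (- m))"
proof -
  interpret prob_space M using M by (simp add: circle_prob_def)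
  have moment0: "moment M 0 = 1" by (simp add: moment_def prob_space)
  have "Poly_Mapping.lookup p k * Poly_Mapping.lookup (caratheodory_jet_0 M (2 * L)) (m - k) -
      Poly_Mapping.lookup p k * Poly_Mapping.lookup (caratheodory_jet_infinity M (2 * L)) (m - k) =
      2 * (Poly_Mapping.lookup p k * moment M (m - k))" if "k \<in> Poly_Mapping.keys p" for k
  proof -
    have "- int L \<le> k" "k \<le> int L" using p that by (auto simp: lp_span_def)
    then have "\<bar>m - k\<bar> \<le> int (2 * L)" using m by auto
    then show ?thesis
      by (auto simp: lookup_caratheodory_jet_0 lookup_caratheodory_jet_infinity moment0)
  qed
  then show ?thesis
    by (simp add: lookup_lpoly_mult LINT_lp_eval_powi[OF M] sum_distrib_left flip: sum_subtractf)
qed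

section \<open>The approximation problem for a single measure\<close>

lemma caratheodory_pade_iff:
  assumes M: "circle_prob M" and p: "p \<in> lp_span L" and l: "l \<le> L"
  shows "(\<lambda>z. lp_eval p z * caratheodory M z + lp_eval q z) \<in> O[at 0](\<lambda>z. z powi int l) \<and>
         (\<lambda>z. lp_eval p z * caratheodory M z + lp_eval q z)
           \<in> O[at_infinity](\<lambda>z. z powi (- int l - 1)) \<longleftrightarrow>
         (\<forall>m<int l. Poly_Mapping.lookup (p * caratheodory_jet_0 M (2 * L) + q) m = 0) \<and>
         (\<forall>m\<ge>- int l. Poly_Mapping.lookup (p * caratheodory_jet_infinity M (2 * L) + q) m = 0)"
proof -
  have supp: "Poly_Mapping.lookup p k = 0" if "k < - int L \<or> int L < k" for k
    using p that by (force simp: lp_span_def in_keys_iff)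
  have powi_infinity: "(\<lambda>z::complex. z powi k) \<in> O[at_infinity](\<lambda>z. z powi l)" if "k \<le> l" for k l
    using powi_bigo_at_0[of "- l" "- k"] that
    by (simp add: bigo_at_infinity_iff power_int_inverse power_int_minus)
  have "(\<lambda>z. lp_eval p z * caratheodory M z + lp_eval q z) \<in> O[at 0](\<lambda>z. z powi int l) \<longleftrightarrow>
      lp_eval (p * caratheodory_jet_0 M (2 * L) + q) \<in> O[at 0](\<lambda>z. z powi int l)"
  proof (rule laurent_approx_bigo_iff)
    show "eventually (\<lambda>z::complex. z \<noteq> 0) (at 0)" by (simp add: eventually_at_filter)
    show "lp_eval p \<in> O[at 0](\<lambda>z. z powi (- int L))"
      unfolding lp_eval_bigo_at_0_iff using supp by auto
    \<comment> \<open>The jet length \<open>2 * L\<close> compensates for the pole of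
      \<open>p\<close> of order up to \<open>L\<close>: the error has order \<open>L + 1\<close>,
      beyond the required \<open>l\<close>.\<close>
    show "(\<lambda>z::complex. z powi (- int L + (int (2 * L) + 1))) \<in> O[at 0](\<lambda>z. z powi int l)"
      by (rule powi_bigo_at_0) (use l in auto)
  qed (rule caratheodory_bigo_at_0[OF M])
  moreover have "(\<lambda>z. lp_eval p z * caratheodory M z + lp_eval q z)
        \<in> O[at_infinity](\<lambda>z. z powi (- int l - 1)) \<longleftrightarrow>
      lp_eval (p * caratheodory_jet_infinity M (2 * L) + q)
        \<in> O[at_infinity](\<lambda>z. z powi (- int l - 1))"
  proof (rule laurent_approx_bigo_iff)
    show "eventually (\<lambda>z::complex. z \<noteq> 0) at_infinity"
      by (auto simp: eventually_at_infinity intro!: exI[of _ 1])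
    show "lp_eval p \<in> O[at_infinity](\<lambda>z. z powi int L)"
      unfolding lp_eval_bigo_at_infinity_iff using supp by auto
    \<comment> \<open>Here the error exponent is \<open>- L - 1\<close>, which is at most
      \<open>- l - 1\<close> because \<open>l \<le> L\<close>.\<close>
    show "(\<lambda>z::complex. z powi (int L + (- int (2 * L) - 1)))
        \<in> O[at_infinity](\<lambda>z. z powi (- int l - 1))"
      by (rule powi_infinity) (use l in auto)
  qed (rule caratheodory_bigo_at_infinity[OF M])
  moreover have "- int l - 1 < m \<longleftrightarrow> - int l \<le> m" for m by auto
  ultimately show ?thesis
    by (simp only: lp_eval_bigo_at_0_iff lp_eval_bigo_at_infinity_iff)
qed

lemma caratheodory_pade_solvable_iff:
  assumes M: "circle_prob M" and p: "p \<in> lp_span L" and l: "l \<le> L"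
  shows "(\<exists>q\<in>lp_span L.
            (\<lambda>z. lp_eval p z * caratheodory M z + lp_eval q z) \<in> O[at 0](\<lambda>z. z powi int l) \<and>
            (\<lambda>z. lp_eval p z * caratheodory M z + lp_eval q z)
              \<in> O[at_infinity](\<lambda>z. z powi (- int l - 1))) \<longleftrightarrow>
         (\<forall>k\<in>{- int l..int l - 1}. (LINT z|M. lp_eval p z * z powi (- k)) = 0)"
    (is "?pade \<longleftrightarrow> ?orth")
proof -
  define s where "s = p * caratheodory_jet_0 M (2 * L)"
  define t where "t = p * caratheodory_jet_infinity M (2 * L)"
  have diff: "Poly_Mapping.lookup s m - Poly_Mapping.lookup t m =
      2 * (LINT w|M. lp_eval p w * w powi (- m))" if "\<bar>m\<bar> \<le> int L" for m
    using lookup_mult_jet_difference[OF M p that] by (simp add: s_def t_def)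
  have "?pade \<longleftrightarrow> (\<exists>q\<in>lp_span L. (\<forall>m<int l. Poly_Mapping.lookup (s + q) m = 0) \<and>
      (\<forall>m\<ge>- int l. Poly_Mapping.lookup (t + q) m = 0))"
    unfolding caratheodory_pade_iff[OF M p l] s_def t_def ..
  also have "\<dots> \<longleftrightarrow> ?orth"
  proof safe
    fix q k
    assume q: "\<forall>m<int l. Poly_Mapping.lookup (s + q) m = 0"
      "\<forall>m\<ge>- int l. Poly_Mapping.lookup (t + q) m = 0" and k: "k \<in> {- int l..int l - 1}"
    then have "Poly_Mapping.lookup (s + q) k - Poly_Mapping.lookup (t + q) k = 0" by auto
    then have "Poly_Mapping.lookup s k - Poly_Mapping.lookup t k = 0" by (simp add: lookup_add)
    moreover have "\<bar>k\<bar> \<le> int L" using k l by auto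
    ultimately show "(LINT z|M. lp_eval p z * z powi (- k)) = 0" using diff by simp
  next
    assume orth: ?orth
    \<comment> \<open>The negative of \<open>q\<close> must equal \<open>s\<close> below
      \<open>l\<close> and \<open>t\<close> from \<open>- l\<close> on. Orthogonality makes
      \<open>s\<close> and \<open>t\<close> agree on the overlap, so switching at \<open>- l\<close>
      satisfies both prescriptions.\<close>
    define c where "c m = (if m < - int l then Poly_Mapping.lookup s m else Poly_Mapping.lookup t m)" for m
    define q where "q = (\<Sum>m\<in>{- int L..int L}. Poly_Mapping.single m (- c m))"
    have lookup_q: "Poly_Mapping.lookup q m = (if m \<in> {- int L..int L} then - c m else 0)" for m
      by (simp add: q_def lookup_sum lookup_single when_def)
    have st: "Poly_Mapping.lookup s m = Poly_Mapping.lookup t m" if "- int l \<le> m" "m < int l" for m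
      using diff[of m] orth that l by auto
    \<comment> \<open>Outside \<open>[- L, L]\<close> the coefficients of \<open>q\<close> vanish,
      so the prescribed values must vanish there too. They do: \<open>p\<close> lives on
      \<open>[- L, L]\<close>, the jet at 0 has no negative powers and the jet at infinity no
      positive ones.\<close>
    have s0: "Poly_Mapping.lookup s m = 0" if "m < - int L" for m
      unfolding s_def lookup_lpoly_mult
      by (intro sum.neutral) (use that p in \<open>force simp: lookup_caratheodory_jet_0 lp_span_def\<close>)
    have t0: "Poly_Mapping.lookup t m = 0" if "int L < m" for m
      unfolding t_def lookup_lpoly_mult
      by (intro sum.neutral) (use that p in \<open>force simp: lookup_caratheodory_jet_infinity lp_span_def\<close>)
    have "q \<in> lp_span L"
      by (auto simp: lp_span_def in_keys_iff lookup_q split: if_splits)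
    moreover have "Poly_Mapping.lookup (s + q) m = 0" if "m < int l" for m
      using that l st[of m] s0[of m] by (auto simp: lookup_add lookup_q c_def)
    moreover have "Poly_Mapping.lookup (t + q) m = 0" if "m \<ge> - int l" for m
      using that l t0[of m] by (auto simp: lookup_add lookup_q c_def)
    ultimately show "\<exists>q\<in>lp_span L. (\<forall>m<int l. Poly_Mapping.lookup (s + q) m = 0) \<and>
      (\<forall>m\<ge>- int l. Poly_Mapping.lookup (t + q) m = 0)" by blast
  qed
  finally show ?thesis .
qed

text \<open>For fixed \<open>\<phi>\<close> the conditions on the different \<open>\<psi> j\<close>
  are independent, so solvability may be checked for each measure separately; choice reassembles the
  family \<open>\<psi>\<close>. Each \<open>n j\<close> is at most the size of \<open>n\<close>, as
  the criterion for a single measure requires.\<close>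

lemma hermite_pade_iff_is_phi:
  assumes "\<And>j. j \<in> {1..r} \<Longrightarrow> circle_prob (\<mu> j)"
  shows "Poly_Mapping.lookup \<phi> (int (mi_size r n div 2)) = 1 \<and> (\<exists>\<psi>. hermite_pade r \<mu> n \<phi> \<psi>) \<longleftrightarrow>
         is_phi r \<mu> n \<phi>"
proof (cases "\<phi> \<in> lp_span (mi_size r n div 2)")
  case True
  have le: "n j div 2 \<le> mi_size r n div 2" if "j \<in> {1..r}" for j
    unfolding mi_size_def using that by (intro div_le_mono member_le_sum) auto
  have "(\<exists>\<psi>. hermite_pade r \<mu> n \<phi> \<psi>) \<longleftrightarrow>
      (\<forall>j\<in>{1..r}. \<exists>q\<in>lp_span (mi_size r n div 2).
        (\<lambda>z. lp_eval \<phi> z * caratheodory (\<mu> j) z + lp_eval q z)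
          \<in> O[at 0](\<lambda>z. z powi int (n j div 2)) \<and>
        (\<lambda>z. lp_eval \<phi> z * caratheodory (\<mu> j) z + lp_eval q z)
          \<in> O[at_infinity](\<lambda>z. z powi (- int (n j div 2) - 1)))"
    using True unfolding hermite_pade_def Bex_def bchoice_iff by simp
  also have "\<dots> \<longleftrightarrow> (\<forall>j\<in>{1..r}. \<forall>k\<in>{- int (n j div 2)..int (n j div 2) - 1}.
        (LINT z|\<mu> j. lp_eval \<phi> z * z powi (- k)) = 0)"
    by (intro ball_cong refl caratheodory_pade_solvable_iff assms True le)
  finally have "(\<exists>\<psi>. hermite_pade r \<mu> n \<phi> \<psi>) \<longleftrightarrow> \<dots>" .
  then show ?thesis using True by (simp add: is_phi_def)
qed (auto simp: hermite_pade_def is_phi_def)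

theorem corollary6p3:
  fixes r :: nat and \<mu> :: "nat \<Rightarrow> complex measure" and n :: "nat \<Rightarrow> nat"
  assumes "r \<ge> 1"
    and "\<And>j. j \<in> {1..r} \<Longrightarrow> circle_prob (\<mu> j)"
    and "\<And>j. j \<in> {1..r} \<Longrightarrow> even (n j)"
  shows "((\<exists>!\<phi>. Poly_Mapping.lookup \<phi> (int (mi_size r n div 2)) = 1 \<and>
              (\<exists>\<psi>. hermite_pade r \<mu> n \<phi> \<psi>)) \<longleftrightarrow> phi_normal r \<mu> n) \<and>
         (phi_normal r \<mu> n \<longrightarrow>
           (\<forall>\<phi>. Poly_Mapping.lookup \<phi> (int (mi_size r n div 2)) = 1 \<and>
              (\<exists>\<psi>. hermite_pade r \<mu> n \<phi> \<psi>) \<longleftrightarrow> \<phi> = phi r \<mu> n))"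
proof -
  \<comment> \<open>Under normality the description defining \<open>phi\<close> denotes the unique
    solution. Everything else follows because the two problems have the same solutions.\<close>
  have "is_phi r \<mu> n \<phi> \<longleftrightarrow> \<phi> = phi r \<mu> n" if "phi_normal r \<mu> n" for \<phi>
    using that theI'[of "is_phi r \<mu> n"] unfolding phi_normal_def phi_def by blast
  moreover note hermite_pade_iff_is_phi[of r \<mu>, OF assms(2)]
  ultimately show ?thesis by (simp add: phi_normal_def)
qed

end
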